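(* Let $(\mathcal{O},g,f)$ be a Euclidean oriented matroid program such that $(\mathcal{O},f,g)$ is an oriented matroid program. Then $(\mathcal{O},f,g)$ is Euclidean.
   Context: Oriented matroid $\mathcal{O}$ on $E$ of rank $r$; cocircuits are the minimal nonzero covectors; $z(X)=\{e:X_e=0\}$, $\mathrm{sep}(X,Y)=\{e:X_e=-Y_e\ne0\}$, conformal means $\mathrm{sep}=\emptyset$. Cocircuits $X\ne\pm Y$ are comodular if $z(X\circ Y)$ is a flat of rank $r-2$; elimination of $e\in\mathrm{sep}(X,Y)$ yields the unique cocircuit $Z$ with $Z_e=0$, $\mathrm{supp}(Z)\subseteq\mathrm{supp}(X\circ Y)\setminus\{e\}$. An oriented matroid program $(\mathcal{O},g,f)$: distinct $g,f\in E$, $g$ not a loop, $f$ not a coloop. For comodular $X,Y$ with $X_g=Y_g\ne0$ and $Z$ the elimination of $g$ between $-X$ and $Y$: $X\to Y$ if $Z_f=+$, $X\leftarrow Y$ if $Z_f=-$, undirected if $Z_f=0$. The graph $G_f$ has vertices the cocircuits with $g=+$, edges the conformal comodular pairs, directed so. The program is Euclidean if $G_f$ has no directed cycle (closed sequence of distinct vertices along edges, each forward or undirected, at least one forward). *)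

theory Defs
  imports Main
begin

(* Signs are the integers -1, 0, 1; a sign vector on E is a function vanishing outside E.
   Negation of sign vectors is the pointwise "- X" of Main. *)

type_synonym 'a signvec = "'a \<Rightarrow> int"

definition sign_vectors :: "'a set \<Rightarrow> 'a signvec set" where
  "sign_vectors E = {X. (\<forall>e. X e \<in> {-1, 0, 1}) \<and> (\<forall>e. e \<notin> E \<longrightarrow> X e = 0)}"

definition zero_vec :: "'a signvec" where
  "zero_vec = (\<lambda>_. 0)"

definition supp :: "'a signvec \<Rightarrow> 'a set" where
  "supp X = {e. X e \<noteq> 0}"

definition zset :: "'a set \<Rightarrow> 'a signvec \<Rightarrow> 'a set" where
  "zset E X = {e \<in> E. X e = 0}"

definition sep :: "'a signvec \<Rightarrow> 'a signvec \<Rightarrow> 'a set" where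
  "sep X Y = {e. X e = - Y e \<and> X e \<noteq> 0}"

definition conformal :: "'a signvec \<Rightarrow> 'a signvec \<Rightarrow> bool" where
  "conformal X Y \<longleftrightarrow> sep X Y = {}"

definition sv_comp :: "'a signvec \<Rightarrow> 'a signvec \<Rightarrow> 'a signvec"  (infixl "\<odot>" 70) where
  "X \<odot> Y = (\<lambda>e. if X e \<noteq> 0 then X e else Y e)"

definition sv_le :: "'a signvec \<Rightarrow> 'a signvec \<Rightarrow> bool" where
  "sv_le X Y \<longleftrightarrow> (\<forall>e. X e = 0 \<or> X e = Y e)"

(* An oriented matroid on E is given by its set L of covectors. *)

locale oriented_matroid =
  fixes E :: "'a set" and L :: "'a signvec set"
  assumes finite_ground: "finite E"
    and covectors_sign: "L \<subseteq> sign_vectors E"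
    and zero_covector: "zero_vec \<in> L"
    and symmetry: "X \<in> L \<Longrightarrow> - X \<in> L"
    and composition: "X \<in> L \<Longrightarrow> Y \<in> L \<Longrightarrow> X \<odot> Y \<in> L"
    and covector_elimination: "X \<in> L \<Longrightarrow> Y \<in> L \<Longrightarrow> e \<in> sep X Y \<Longrightarrow>
      \<exists>Z\<in>L. Z e = 0 \<and> (\<forall>h. h \<notin> sep X Y \<longrightarrow> Z h = (X \<odot> Y) h)"

definition cocircuits :: "'a signvec set \<Rightarrow> 'a signvec set" where
  "cocircuits L = {X \<in> L. X \<noteq> zero_vec \<and>
     (\<forall>Y\<in>L. Y \<noteq> zero_vec \<longrightarrow> sv_le Y X \<longrightarrow> Y = X)}"

(* The underlying matroid: its flats are the zero sets of the covectors. *)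

definition om_flat :: "'a set \<Rightarrow> 'a signvec set \<Rightarrow> 'a set \<Rightarrow> bool" where
  "om_flat E L F \<longleftrightarrow> F \<in> zset E ` L"

definition om_closure :: "'a set \<Rightarrow> 'a signvec set \<Rightarrow> 'a set \<Rightarrow> 'a set" where
  "om_closure E L A = \<Inter>{F. om_flat E L F \<and> A \<subseteq> F}"

definition om_indep :: "'a set \<Rightarrow> 'a signvec set \<Rightarrow> 'a set \<Rightarrow> bool" where
  "om_indep E L I \<longleftrightarrow> I \<subseteq> E \<and> (\<forall>e\<in>I. e \<notin> om_closure E L (I - {e}))"

definition om_basis :: "'a set \<Rightarrow> 'a signvec set \<Rightarrow> 'a set \<Rightarrow> bool" where
  "om_basis E L B \<longleftrightarrow> om_indep E L B \<and> (\<forall>I. om_indep E L I \<longrightarrow> B \<subseteq> I \<longrightarrow> I = B)"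

definition om_rank :: "'a set \<Rightarrow> 'a signvec set \<Rightarrow> 'a set \<Rightarrow> nat" where
  "om_rank E L A = Max (card ` {I. I \<subseteq> A \<and> om_indep E L I})"

definition om_loop :: "'a set \<Rightarrow> 'a signvec set \<Rightarrow> 'a \<Rightarrow> bool" where
  "om_loop E L e \<longleftrightarrow> e \<in> E \<and> \<not> om_indep E L {e}"

definition om_coloop :: "'a set \<Rightarrow> 'a signvec set \<Rightarrow> 'a \<Rightarrow> bool" where
  "om_coloop E L e \<longleftrightarrow> e \<in> E \<and> (\<forall>B. om_basis E L B \<longrightarrow> e \<in> B)"

(* Rank r - 2 is written "rank + 2 = r" because of truncated subtraction. *)

definition comodular :: "'a set \<Rightarrow> 'a signvec set \<Rightarrow> 'a signvec \<Rightarrow> 'a signvec \<Rightarrow> bool" where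
  "comodular E L X Y \<longleftrightarrow> X \<in> cocircuits L \<and> Y \<in> cocircuits L \<and> X \<noteq> Y \<and> X \<noteq> - Y \<and>
     om_flat E L (zset E (X \<odot> Y)) \<and> om_rank E L (zset E (X \<odot> Y)) + 2 = om_rank E L E"

(* Z is the cocircuit obtained by eliminating e between X and Y. The support condition alone
   determines Z only up to sign; the last clause is the sign condition of cocircuit elimination
   (positive part of Z inside the union of the positive parts of X and Y, likewise for the
   negative parts) and selects the right one of the two. *)

definition eliminates ::
    "'a signvec set \<Rightarrow> 'a \<Rightarrow> 'a signvec \<Rightarrow> 'a signvec \<Rightarrow> 'a signvec \<Rightarrow> bool" where
  "eliminates L e X Y Z \<longleftrightarrow> Z \<in> cocircuits L \<and> Z e = 0 \<and> supp Z \<subseteq> supp (X \<odot> Y) - {e} \<and>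
     (\<forall>h. Z h \<noteq> 0 \<longrightarrow> Z h = X h \<or> Z h = Y h)"

definition om_program :: "'a set \<Rightarrow> 'a signvec set \<Rightarrow> 'a \<Rightarrow> 'a \<Rightarrow> bool" where
  "om_program E L g f \<longleftrightarrow> oriented_matroid E L \<and> g \<in> E \<and> f \<in> E \<and> g \<noteq> f \<and>
     \<not> om_loop E L g \<and> \<not> om_coloop E L f"

definition Gf_vertices :: "'a signvec set \<Rightarrow> 'a \<Rightarrow> 'a signvec set" where
  "Gf_vertices L g = {X \<in> cocircuits L. X g = 1}"

definition Gf_edge :: "'a set \<Rightarrow> 'a signvec set \<Rightarrow> 'a \<Rightarrow> 'a signvec \<Rightarrow> 'a signvec \<Rightarrow> bool" where
  "Gf_edge E L g X Y \<longleftrightarrow> X \<in> Gf_vertices L g \<and> Y \<in> Gf_vertices L g \<and>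
     conformal X Y \<and> comodular E L X Y"

definition forward_edge ::
    "'a set \<Rightarrow> 'a signvec set \<Rightarrow> 'a \<Rightarrow> 'a \<Rightarrow> 'a signvec \<Rightarrow> 'a signvec \<Rightarrow> bool" where
  "forward_edge E L g f X Y \<longleftrightarrow> Gf_edge E L g X Y \<and> (\<exists>Z. eliminates L g (- X) Y Z \<and> Z f = 1)"

definition undirected_edge ::
    "'a set \<Rightarrow> 'a signvec set \<Rightarrow> 'a \<Rightarrow> 'a \<Rightarrow> 'a signvec \<Rightarrow> 'a signvec \<Rightarrow> bool" where
  "undirected_edge E L g f X Y \<longleftrightarrow> Gf_edge E L g X Y \<and> (\<exists>Z. eliminates L g (- X) Y Z \<and> Z f = 0)"

definition Gf_directed_cycle ::
    "'a set \<Rightarrow> 'a signvec set \<Rightarrow> 'a \<Rightarrow> 'a \<Rightarrow> 'a signvec list \<Rightarrow> bool" where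
  "Gf_directed_cycle E L g f Xs \<longleftrightarrow> distinct Xs \<and>
     (\<forall>i<length Xs. let X = Xs ! i; Y = Xs ! (Suc i mod length Xs)
        in forward_edge E L g f X Y \<or> undirected_edge E L g f X Y) \<and>
     (\<exists>i<length Xs. forward_edge E L g f (Xs ! i) (Xs ! (Suc i mod length Xs)))"

definition euclidean_program :: "'a set \<Rightarrow> 'a signvec set \<Rightarrow> 'a \<Rightarrow> 'a \<Rightarrow> bool" where
  "euclidean_program E L g f \<longleftrightarrow> om_program E L g f \<and> (\<nexists>Xs. Gf_directed_cycle E L g f Xs)"

end

theory Submission
  imports Defs
begin

text \<open>
  Along an edge \<open>X \<rightarrow> Y\<close> of the graph of \<open>(\<O>, f, g)\<close> that is forward or undirected one
  has \<open>X g \<le> Y g\<close>, so \<open>g\<close> is constant on a directed cycle, and this constant \<open>s\<close> is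
  nonzero because a forward edge cannot lie in the hyperplane \<open>g = 0\<close>. Multiplying the vertices
  of the cycle by \<open>s\<close> and reversing it then gives a directed cycle of \<open>(\<O>, g, f)\<close>:
  on the pseudoline through \<open>X\<close> and \<open>Y\<close>, moving towards the point
  \<open>f = 0, g = +\<close> means moving away from the point \<open>g = 0, f = s\<close>.
\<close>

text \<open>Entry \<open>i\<close> of a reversed list of length \<open>n\<close> is entry
  \<open>n - Suc i\<close> of the list, so its cyclic step leaving \<open>i\<close> is the original
  step leaving \<open>j\<close>, run backwards. The last equation makes this matching of steps an
  involution.\<close>

lemma reversed_index:
  fixes i n :: nat
  assumes "i < n"
  defines "j \<equiv> n - Suc (Suc i mod n)"
  shows "j < n" "Suc j mod n = n - Suc i" "n - Suc (Suc j mod n) = i"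
proof -
  show 1: "Suc j mod n = n - Suc i"
  proof (cases "Suc i = n")
    case True
    then have "Suc j = n" using j_def by auto
    then show ?thesis using True by simp
  next
    case False
    then have "Suc i < n" using assms(1) by simp
    then have "Suc j = n - Suc i" using j_def by simp
    then show ?thesis using assms(1) by simp
  qed
  show "j < n" using assms(1) j_def by simp
  show "n - Suc (Suc j mod n) = i" unfolding 1 using assms(1) by simp
qed

section \<open>Sign vectors\<close>

lemma sv_uminus_uminus [simp]: "- (- X) = (X :: 'a signvec)"
  by (simp add: fun_eq_iff)

lemma sv_uminus_eq_iff [simp]: "- X = - Y \<longleftrightarrow> X = (Y :: 'a signvec)"
  by (simp add: fun_eq_iff)

lemma supp_comp: "supp (X \<odot> Y) = supp X \<union> supp Y"
  by (auto simp: supp_def sv_comp_def)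

lemma zset_comp_commute: "zset E (X \<odot> Y) = zset E (Y \<odot> X)"
  by (auto simp: zset_def sv_comp_def)

lemma supp_uminus [simp]: "supp (- X) = supp X"
  by (auto simp: supp_def)

lemma sv_le_supp: "sv_le X Y \<Longrightarrow> supp X \<subseteq> supp Y"
  by (fastforce simp: supp_def sv_le_def)

lemma sep_commute: "sep X Y = sep Y X"
  by (auto simp: sep_def)

lemma eliminates_supp: "eliminates L e (- X) Y Z \<Longrightarrow> supp Z \<subseteq> supp X \<union> supp Y"
  by (auto simp: eliminates_def supp_comp)

lemma eliminates_sign: "eliminates L e (- X) Y Z \<Longrightarrow> Z h \<noteq> 0 \<Longrightarrow> Z h = - X h \<or> Z h = Y h"
  by (simp add: eliminates_def)

text \<open>For a covector with \<open>X g \<noteq> 0\<close> this is multiplication by the sign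
  \<open>X g\<close>, which brings it to the side \<open>g = 1\<close>.\<close>

definition orient :: "'a \<Rightarrow> 'a signvec \<Rightarrow> 'a signvec" where
  "orient g X = (if X g = 1 then X else - X)"

context oriented_matroid
begin

section \<open>Rank\<close>

lemma covector_values: "X \<in> L \<Longrightarrow> X e \<in> {-1, 0, 1}"
  using covectors_sign by (auto simp: sign_vectors_def)

lemma covector_supp: "X \<in> L \<Longrightarrow> supp X \<subseteq> E"
  using covectors_sign by (force simp: sign_vectors_def supp_def)

lemma om_flat_subset: "om_flat E L F \<Longrightarrow> F \<subseteq> E"
  by (auto simp: om_flat_def zset_def)

lemma om_flat_zset: "X \<in> L \<Longrightarrow> om_flat E L (zset E X)"
  by (simp add: om_flat_def)

text \<open>A flat containing \<open>I\<close> but not \<open>e\<close> is the zero set of a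
  covector vanishing on \<open>I\<close> and nonzero at \<open>e\<close>; this turns independence
  into a statement about covectors.\<close>

lemma notin_closure_iff:
  assumes "I \<subseteq> E" "e \<in> E"
  shows "e \<notin> om_closure E L I \<longleftrightarrow> (\<exists>A\<in>L. (\<forall>i\<in>I. A i = 0) \<and> A e \<noteq> 0)"
proof -
  have "I \<subseteq> zset E A \<longleftrightarrow> (\<forall>i\<in>I. A i = 0)" "e \<in> zset E A \<longleftrightarrow> A e = 0" for A
    using assms by (auto simp: zset_def)
  then show ?thesis by (auto simp: om_closure_def om_flat_def)
qed

lemma indep_insert:
  assumes I: "om_indep E L I" and F: "om_flat E L F" "I \<subseteq> F" and e: "e \<in> E" "e \<notin> F"
  shows "om_indep E L (insert e I)"
proof -
  obtain B where B: "B \<in> L" "F = zset E B" using F(1) by (auto simp: om_flat_def)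
  have IE: "I \<subseteq> E" using I by (simp add: om_indep_def)
  have BI: "B i = 0" if "i \<in> I" for i using that B F by (auto simp: zset_def)
  have Be: "B e \<noteq> 0" using B e by (auto simp: zset_def)
  have eI: "e \<notin> I" using F e by auto
  have 1: "e \<notin> om_closure E L I" using notin_closure_iff[OF IE e(1)] B(1) BI Be by blast
  have 2: "i \<notin> om_closure E L (insert e I - {i})" if i: "i \<in> I" for i
  proof -
    have "i \<notin> om_closure E L (I - {i})" using I i by (simp add: om_indep_def)
    then obtain A where A: "A \<in> L" "\<forall>j\<in>I - {i}. A j = 0" "A i \<noteq> 0"
      using notin_closure_iff[of "I - {i}" i] IE i by blast
    have "\<exists>C\<in>L. (\<forall>j\<in>I - {i}. C j = 0) \<and> C e = 0 \<and> C i \<noteq> 0"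
    proof (cases "A e = 0")
      case True then show ?thesis using A by blast
    next
      case False
      \<comment> \<open>\<open>B'\<close> is whichever of \<open>B\<close>, \<open>- B\<close>
        opposes \<open>A\<close> at \<open>e\<close>. Since it vanishes on \<open>I\<close>,
        eliminating \<open>e\<close> leaves the values of \<open>A\<close> on \<open>I\<close>
        unchanged.\<close>
      obtain B' where B': "B' \<in> L" "B' e = - A e" "\<forall>j\<in>I. B' j = 0"
      proof (cases "B e = - A e")
        case True then show ?thesis using that B BI by blast
      next
        case F: False
        have "(- B) e = - A e"
          using covector_values[OF A(1), of e] covector_values[OF B(1), of e] F False Be by auto
        then show ?thesis using that[of "- B"] symmetry[OF B(1)] BI by simp
      qed
      have "e \<in> sep A B'" using B' False by (simp add: sep_def)
      then obtain C where C: "C \<in> L" "C e = 0" "\<forall>h. h \<notin> sep A B' \<longrightarrow> C h = (A \<odot> B') h"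
        using covector_elimination[OF A(1) B'(1)] by blast
      have "j \<notin> sep A B'" if "j \<in> I" for j using that B' by (auto simp: sep_def)
      then have "C j = (A \<odot> B') j" if "j \<in> I" for j using that C by blast
      then have "C j = A j" if "j \<in> I" for j using that B' by (simp add: sv_comp_def)
      then have "\<forall>j\<in>I - {i}. C j = 0" "C i \<noteq> 0" using A i by auto
      then show ?thesis using C by blast
    qed
    then obtain C where "C \<in> L" "\<forall>j\<in>insert e I - {i}. C j = 0" "C i \<noteq> 0" by auto
    then show ?thesis using notin_closure_iff[of "insert e I - {i}" i] IE i e by blast
  qed
  show ?thesis using 1 2 eI IE e by (auto simp: om_indep_def insert_Diff_if)
qed

lemma finite_indep_subsets: "A \<subseteq> E \<Longrightarrow> finite {I. I \<subseteq> A \<and> om_indep E L I}"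
  by (rule finite_subset[of _ "Pow E"]) (auto simp: finite_ground)

text \<open>A largest independent subset of \<open>F\<close> stays independent when an element of
  \<open>F' - F\<close> joins it, because \<open>F\<close> is a flat.\<close>

lemma om_rank_strict_mono:
  assumes F: "om_flat E L F" "F \<subset> F'" "F' \<subseteq> E"
  shows "om_rank E L F < om_rank E L F'"
proof -
  have FE: "F \<subseteq> E" using F by auto
  have "om_indep E L {}" by (simp add: om_indep_def)
  then have "card ` {I. I \<subseteq> F \<and> om_indep E L I} \<noteq> {}" by auto
  then have "om_rank E L F \<in> card ` {I. I \<subseteq> F \<and> om_indep E L I}"
    unfolding om_rank_def using finite_indep_subsets[OF FE] by (intro Max_in) auto
  then obtain I where I: "I \<subseteq> F" "om_indep E L I" "card I = om_rank E L F" by auto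
  obtain e where e: "e \<in> F'" "e \<notin> F" using F by auto
  have "om_indep E L (insert e I)" using indep_insert[OF I(2) F(1) I(1)] e F by blast
  then have "card (insert e I) \<le> om_rank E L F'"
    unfolding om_rank_def using finite_indep_subsets[OF F(3)] I e F by (intro Max_ge) auto
  moreover have "card (insert e I) = Suc (card I)"
    using I e FE finite_ground by (metis card_insert_disjoint finite_subset subsetD)
  ultimately show ?thesis using I by simp
qed

section \<open>Cocircuits\<close>

lemma uminus_cocircuit: "X \<in> cocircuits L \<Longrightarrow> - X \<in> cocircuits L"
proof -
  assume X: "X \<in> cocircuits L"
  have "Y = - X" if "Y \<in> L" "Y \<noteq> zero_vec" "sv_le Y (- X)" for Y
  proof -
    have "- Y \<in> L" "- Y \<noteq> zero_vec" "sv_le (- Y) X"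
      using that symmetry by (auto simp: zero_vec_def sv_le_def fun_eq_iff)
    then have "- Y = X" using X by (auto simp: cocircuits_def)
    then show ?thesis by auto
  qed
  moreover have "- X \<noteq> zero_vec" using X by (auto simp: cocircuits_def zero_vec_def fun_eq_iff)
  ultimately show ?thesis using X symmetry by (auto simp: cocircuits_def)
qed

lemma cocircuit_below:
  assumes "V \<in> L" "V \<noteq> zero_vec"
  shows "\<exists>C\<in>cocircuits L. sv_le C V"
  using assms
proof (induction "card (supp V)" arbitrary: V rule: less_induct)
  case less
  show ?case
  proof (cases "V \<in> cocircuits L")
    case True then show ?thesis by (auto simp: sv_le_def)
  next
    case False
    then obtain Y where Y: "Y \<in> L" "Y \<noteq> zero_vec" "sv_le Y V" "Y \<noteq> V"
      using less.prems by (auto simp: cocircuits_def)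
    obtain e where "Y e \<noteq> V e" using Y(4) by (auto simp: fun_eq_iff)
    then have "e \<in> supp V - supp Y" using Y(3) by (auto simp: sv_le_def supp_def)
    then have "supp Y \<subset> supp V" using sv_le_supp[OF Y(3)] by auto
    then have "card (supp Y) < card (supp V)"
      using covector_supp[OF less.prems(1)] finite_ground by (meson finite_subset psubset_card_mono)
    then obtain C where "C \<in> cocircuits L" "sv_le C Y" using less.hyps Y by blast
    moreover have "sv_le C V" using \<open>sv_le C Y\<close> Y(3) by (metis sv_le_def)
    ultimately show ?thesis by blast
  qed
qed

text \<open>Cocircuits are minimal in the sign order; here minimality passes to supports.
  Eliminating a disagreement \<open>h\<close> gives \<open>S\<close> with fewer disagreements with
  \<open>U\<close>, so by induction \<open>S\<close> is zero or parallel to \<open>U\<close>. The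
  latter fails at \<open>h\<close>, the former means \<open>T = - U\<close>.\<close>

lemma cocircuit_supp_unique:
  assumes U: "U \<in> cocircuits L" and T: "T \<in> L" "T \<noteq> zero_vec" "supp T \<subseteq> supp U"
  shows "T = U \<or> T = - U"
  using T
proof (induction "card (sep U T)" arbitrary: T rule: less_induct)
  case less
  have UL: "U \<in> L" using U by (simp add: cocircuits_def)
  show ?case
  proof (cases "sep U T = {}")
    case True
    have "sv_le T U" unfolding sv_le_def
    proof
      fix e show "T e = 0 \<or> T e = U e"
        using equals0D[OF True, of e] less.prems(3) covector_values[OF UL, of e] covector_values[OF less.prems(1), of e]
        by (auto simp: sep_def supp_def)
    qed
    then show ?thesis using U less.prems by (auto simp: cocircuits_def)
  next
    case False
    then obtain h where h: "h \<in> sep U T" by auto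
    then obtain S where S: "S \<in> L" "S h = 0" "\<forall>k. k \<notin> sep U T \<longrightarrow> S k = (U \<odot> T) k"
      using covector_elimination[OF UL less.prems(1)] by blast
    have Uh: "U h \<noteq> 0" using h by (simp add: sep_def)
    have SU: "S k = U k" if "k \<notin> sep U T" for k
      using S(3) that less.prems(3) by (auto simp: sv_comp_def supp_def)
    show ?thesis
    proof (cases "S = zero_vec")
      case True
      have "T k = - U k" for k
        using SU[of k] True less.prems(3) by (cases "k \<in> sep U T") (auto simp: sep_def zero_vec_def supp_def)
      then show ?thesis by (auto simp: fun_eq_iff)
    next
      case False
      have "sep U S \<subseteq> sep U T - {h}"
      proof
        fix k assume k: "k \<in> sep U S"
        then have "S k \<noteq> U k" "k \<noteq> h" using S(2) by (auto simp: sep_def)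
        then show "k \<in> sep U T - {h}" using SU by blast
      qed
      then have "sep U S \<subset> sep U T" using h by auto
      moreover have "sep U T \<subseteq> E" using covector_supp[OF UL] by (auto simp: sep_def supp_def)
      ultimately have "card (sep U S) < card (sep U T)"
        using finite_ground by (meson finite_subset psubset_card_mono)
      moreover have "supp S \<subseteq> supp U"
      proof
        fix k assume "k \<in> supp S"
        then show "k \<in> supp U" using SU[of k] by (cases "k \<in> sep U T") (auto simp: supp_def sep_def)
      qed
      ultimately have "S = U \<or> S = - U" using less.hyps S(1) False by blast
      then show ?thesis using S(2) Uh by auto
    qed
  qed
qed

text \<open>A cocircuit below the covector given by elimination inherits its zero at
  \<open>e\<close> and satisfies the sign condition. That covector is nonzero: it keeps a nonzero
  value wherever \<open>X\<close> and \<open>- Y\<close> differ.\<close>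

lemma eliminates_exists:
  assumes X: "X \<in> L" and Y: "Y \<in> L" and "X \<noteq> - Y" and "e \<in> sep X Y"
  shows "\<exists>Z. eliminates L e X Y Z"
proof -
  obtain V where V: "V \<in> L" "V e = 0" "\<forall>h. h \<notin> sep X Y \<longrightarrow> V h = (X \<odot> Y) h"
    using covector_elimination[OF X Y] assms by blast
  obtain h where h: "X h \<noteq> - Y h" using assms(3) by (auto simp: fun_eq_iff)
  then have "V h = (X \<odot> Y) h" using V(3) by (auto simp: sep_def)
  then have "V h \<noteq> 0" using h by (auto simp: sv_comp_def split: if_splits)
  then have "V \<noteq> zero_vec" by (auto simp: zero_vec_def)
  then obtain Z where Z: "Z \<in> cocircuits L" "sv_le Z V" using cocircuit_below V by blast
  have Ze: "Z e = 0" using Z V(2) by (auto simp: sv_le_def)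
  have signs: "Z k = X k \<or> Z k = Y k" if "Z k \<noteq> 0" for k
  proof (cases "k \<in> sep X Y")
    \<comment> \<open>On \<open>sep X Y\<close> both nonzero signs occur, so the value of
      \<open>Z\<close> matches one of them.\<close>
    case True
    then show ?thesis
      using that Z covector_values[of Z k] covector_values[OF X, of k] covector_values[OF Y, of k]
      by (auto simp: sep_def cocircuits_def)
  next
    case False
    then have "Z k = (X \<odot> Y) k" using that Z(2) V(3) by (metis sv_le_def)
    then show ?thesis by (auto simp: sv_comp_def)
  qed
  then have "supp Z \<subseteq> supp (X \<odot> Y) - {e}"
    using Ze by (force simp: supp_def sv_comp_def)
  then show ?thesis using Z(1) Ze signs by (auto simp: eliminates_def)
qed

text \<open>
  The covectors supported on \<open>supp X \<union> supp Y\<close> form an oriented matroid of rank two, in which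
  two cocircuits that are not parallel have no common zero other than the loops.
\<close>

lemma comodular_common_zero:
  assumes XY: "comodular E L X Y"
    and U: "U \<in> cocircuits L" "supp U \<subseteq> supp X \<union> supp Y"
    and V: "V \<in> cocircuits L" "supp V \<subseteq> supp X \<union> supp Y"
    and "U \<noteq> V" "U \<noteq> - V" "U e = 0" "V e = 0"
  shows "X e = 0 \<and> Y e = 0"
proof (rule ccontr)
  assume nz: "\<not> (X e = 0 \<and> Y e = 0)"
  have L: "X \<in> L" "Y \<in> L" "U \<in> L" "V \<in> L" "U \<noteq> zero_vec" "V \<noteq> zero_vec"
    using XY U V by (auto simp: comodular_def cocircuits_def)
  \<comment> \<open>A common zero \<open>e\<close> outside the zeros of \<open>X \<odot> Y\<close>
    would give a strict chain \<open>?F \<subset> ?G \<subset> ?H \<subset> E\<close> along which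
    the rank grows by at least three, against the two of comodularity.\<close>
  let ?F = "zset E (X \<odot> Y)" let ?G = "zset E (U \<odot> V)" let ?H = "zset E U"
  have e: "e \<in> E" using nz covector_supp L by (auto simp: supp_def)
  have "?F \<subset> ?G"
  proof
    show "?F \<subseteq> ?G" using U(2) V(2) by (auto simp: zset_def sv_comp_def supp_def split: if_splits)
    have "(X \<odot> Y) e \<noteq> 0" "(U \<odot> V) e = 0" using assms(8,9) nz by (simp_all add: sv_comp_def)
    then have "e \<in> ?G" "e \<notin> ?F" using e by (simp_all add: zset_def)
    then show "?F \<noteq> ?G" by blast
  qed
  moreover have "?G \<subset> ?H"
  proof
    show "?G \<subseteq> ?H" by (auto simp: zset_def sv_comp_def split: if_splits)
    have "\<not> supp V \<subseteq> supp U" using cocircuit_supp_unique[OF U(1) L(4,6)] assms(6,7) by auto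
    then obtain k where "V k \<noteq> 0" "U k = 0" by (auto simp: supp_def)
    moreover have "k \<in> E" using covector_supp[OF L(4)] \<open>V k \<noteq> 0\<close> by (auto simp: supp_def)
    ultimately have "k \<in> ?H" "k \<notin> ?G" by (auto simp: zset_def sv_comp_def)
    then show "?G \<noteq> ?H" by blast
  qed
  moreover have "?H \<subset> E"
    using L(5) covector_supp[OF L(3)] by (auto simp: zset_def zero_vec_def supp_def fun_eq_iff)
  ultimately have "om_rank E L ?F < om_rank E L ?G" "om_rank E L ?G < om_rank E L ?H"
    "om_rank E L ?H < om_rank E L E"
    using om_rank_strict_mono om_flat_zset om_flat_subset composition L by auto
  then show False using XY by (simp add: comodular_def)
qed

section \<open>Exchanging the two elements\<close>

text \<open>Conformality allows \<open>g\<close> to drop only from 1 to 0 or from 0 to -1, and then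
  the signs available to \<open>Z\<close> force \<open>Z g = 0\<close>. So \<open>Z\<close> shares
  the zero \<open>g\<close> with \<open>X\<close> or \<open>Y\<close>, to neither of which it is
  parallel.\<close>

lemma step_mono:
  assumes XY: "comodular E L X Y" "conformal X Y" "X f = 1" "Y f = 1"
    and Z: "eliminates L f (- X) Y Z" "Z g \<in> {0, 1}"
  shows "X g \<le> Y g"
proof (rule ccontr)
  assume less: "\<not> X g \<le> Y g"
  have L: "X \<in> cocircuits L" "Y \<in> cocircuits L" "X \<in> L" "Y \<in> L"
    using XY by (auto simp: comodular_def cocircuits_def)
  have Zc: "Z \<in> cocircuits L" "Z f = 0" and Zg: "Z g \<noteq> 0 \<Longrightarrow> Z g = - X g \<or> Z g = Y g"
    using Z(1) eliminates_sign by (auto simp: eliminates_def)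
  have "\<not> (X g = - Y g \<and> X g \<noteq> 0)" using XY(2) by (auto simp: conformal_def sep_def)
  with less have cases: "X g = 1 \<and> Y g = 0 \<or> X g = 0 \<and> Y g = -1"
    using covector_values[OF L(3), of g] covector_values[OF L(4), of g] by auto
  with Z(2) Zg have Zg0: "Z g = 0" by auto
  have ne: "Z \<noteq> X" "Z \<noteq> - X" "Z \<noteq> Y" "Z \<noteq> - Y" using Zc(2) XY(3,4) by auto
  note Z_common_zero = comodular_common_zero[OF XY(1) Zc(1) eliminates_supp[OF Z(1)]]
  have "X g = 0 \<and> Y g = 0"
    using Z_common_zero[OF L(1) Un_upper1 ne(1,2) Zg0] Z_common_zero[OF L(2) Un_upper2 ne(3,4) Zg0]
      cases by blast
  then show False using cases by auto
qed

text \<open>If \<open>W f\<close> had the wrong sign, combining \<open>Z\<close> and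
  \<open>W\<close> would give a covector that vanishes with \<open>X\<close> at some
  \<open>h\<close> but whose signs at \<open>f\<close> and \<open>g\<close> have the opposite
  product to those of \<open>X\<close>.\<close>

lemma exchanged_elimination_sign:
  assumes XY: "comodular E L X Y" "X f = 1" "Y f = 1" "X g = Y g" "X g \<noteq> 0"
    and Z: "eliminates L f (- X) Y Z" "Z g = 1"
    and W: "eliminates L g (- Y) X W"
  shows "W f = X g"
proof (rule ccontr)
  assume neq: "W f \<noteq> X g"
  have L: "X \<in> cocircuits L" "Y \<in> cocircuits L" "X \<in> L" "Y \<in> L" "X \<noteq> zero_vec" "Y \<noteq> zero_vec"
    using XY by (auto simp: comodular_def cocircuits_def)
  have Zc: "Z \<in> cocircuits L" "Z f = 0" "Z \<in> L"
    and Wc: "W \<in> cocircuits L" "W g = 0" "W \<in> L"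
    using Z W by (auto simp: eliminates_def cocircuits_def)
  have sZ: "supp Z \<subseteq> supp X \<union> supp Y" and sW: "supp W \<subseteq> supp X \<union> supp Y"
    using eliminates_supp[OF Z(1)] eliminates_supp[OF W] by auto
  have "Z \<noteq> W" "Z \<noteq> - W" using Z(2) Wc(2) by auto
  then have "W f \<noteq> 0"
    using comodular_common_zero[OF XY(1) Zc(1) sZ Wc(1) sW _ _ Zc(2)] XY(2) by auto
  with neq have Wf: "W f = - X g"
    using covector_values[OF Wc(3), of f] covector_values[OF L(3), of g] XY by auto
  \<comment> \<open>At a zero \<open>h\<close> of \<open>X\<close> only \<open>Y\<close> determines
    the signs: \<open>Z\<close> takes \<open>Y h\<close> and \<open>W\<close> takes
    \<open>- Y h\<close>, so \<open>h\<close> can be eliminated between them.\<close>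
  have "\<not> supp Y \<subseteq> supp X"
    using cocircuit_supp_unique[OF L(1) L(4,6)] XY(1) by (auto simp: comodular_def)
  then obtain h where h: "Y h \<noteq> 0" "X h = 0" by (auto simp: supp_def)
  have ne: "Z \<noteq> X" "Z \<noteq> - X" "W \<noteq> X" "W \<noteq> - X" using Zc(2) Wc(2) XY(2,5) by auto
  have "Z h \<noteq> 0" "W h \<noteq> 0"
    using comodular_common_zero[OF XY(1) Zc(1) sZ L(1) Un_upper1 ne(1,2) _ h(2)]
      comodular_common_zero[OF XY(1) Wc(1) sW L(1) Un_upper1 ne(3,4) _ h(2)] h(1) by auto
  then have "Z h = Y h" "W h = - Y h" using Z(1) W h(2) by (auto simp: eliminates_def)
  then have "h \<in> sep Z W" using h by (auto simp: sep_def)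
  then obtain U where U: "U \<in> L" "U h = 0" "\<forall>k. k \<notin> sep Z W \<longrightarrow> U k = (Z \<odot> W) k"
    using covector_elimination[OF Zc(3) Wc(3)] by blast
  \<comment> \<open>Exactly one of \<open>Z\<close>, \<open>W\<close> vanishes at \<open>f\<close>,
    and likewise at \<open>g\<close>, so the elimination keeps the nonzero values \<open>W f\<close>
    and \<open>Z g\<close>.\<close>
  have Uf: "U f = - X g" and Ug: "U g = 1"
    using U(3) Zc(2) Wc(2) Z(2) Wf by (auto simp: sep_def sv_comp_def)
  have sU: "U k = 0" if "X k = 0" "Y k = 0" for k
  proof -
    have "Z k = 0" "W k = 0" using that sZ sW by (auto simp: supp_def)
    then show ?thesis using U(3) by (auto simp: sep_def sv_comp_def)
  qed
  \<comment> \<open>Both \<open>U\<close> and \<open>X\<close> vanish at \<open>h\<close>, so they should be parallel; but their signs at \<open>f\<close>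
    and \<open>g\<close> say otherwise.\<close>
  obtain U' where U': "U' \<in> L" "U' h = 0" "U' f = -1" "U' g = X g"
    "\<And>k. X k = 0 \<Longrightarrow> Y k = 0 \<Longrightarrow> U' k = 0"
  proof (cases "X g = 1")
    case True then show ?thesis using that[of U] U Uf Ug sU by simp
  next
    case False
    then have "X g = -1" using covector_values[OF L(3), of g] XY by auto
    then show ?thesis using that[of "- U"] U Uf Ug sU symmetry by simp
  qed
  \<comment> \<open>\<open>U'\<close> need not be a cocircuit. Eliminating \<open>f\<close> against
    \<open>X\<close> and passing to a cocircuit \<open>C\<close> below keeps the zero at
    \<open>h\<close> and adds one at \<open>f\<close>, so \<open>C\<close> is not parallel to
    \<open>X\<close>; the agreement of \<open>U'\<close> and \<open>X\<close> at \<open>g\<close>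
    makes \<open>T\<close> nonzero.\<close>
  have "f \<in> sep U' X" using U'(3) XY(2) by (simp add: sep_def)
  then obtain T where T: "T \<in> L" "T f = 0" "\<forall>k. k \<notin> sep U' X \<longrightarrow> T k = (U' \<odot> X) k"
    using covector_elimination[OF U'(1) L(3)] by blast
  have "T g \<noteq> 0" using T(3) U'(4) XY(5) by (auto simp: sep_def sv_comp_def)
  then have "T \<noteq> zero_vec" by (auto simp: zero_vec_def)
  then obtain C where C: "C \<in> cocircuits L" "sv_le C T" using cocircuit_below T by blast
  have "T h = 0" using T(3) U'(2) h(2) by (auto simp: sep_def sv_comp_def)
  then have Ch: "C h = 0" and Cf: "C f = 0" using C(2) T by (auto simp: sv_le_def)
  have "T k = 0" if "X k = 0" "Y k = 0" for k
    using T(3) U'(5)[OF that] that by (auto simp: sep_def sv_comp_def)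
  then have "supp T \<subseteq> supp X \<union> supp Y" by (auto simp: supp_def)
  then have sC: "supp C \<subseteq> supp X \<union> supp Y" using sv_le_supp[OF C(2)] by auto
  have "C \<noteq> X" "C \<noteq> - X" using Cf XY(2) by auto
  then show False
    using comodular_common_zero[OF XY(1) C(1) sC L(1) Un_upper1 _ _ Ch h(2)] h(1) by auto
qed

section \<open>Edges under reversal, negation and the exchange of \<open>f\<close> and
  \<open>g\<close>\<close>

lemma comodular_commute: "comodular E L X Y \<Longrightarrow> comodular E L Y X"
  using zset_comp_commute[of E X Y] by (auto simp: comodular_def)

lemma comodular_uminus: "comodular E L X Y \<Longrightarrow> comodular E L (- X) (- Y)"
proof -
  assume "comodular E L X Y"
  moreover have "zset E (- X \<odot> - Y) = zset E (X \<odot> Y)" by (auto simp: zset_def sv_comp_def)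
  ultimately show ?thesis using uminus_cocircuit by (auto simp: comodular_def)
qed

lemma eliminates_uminus: "eliminates L e X Y Z \<Longrightarrow> eliminates L e (- X) (- Y) (- Z)"
  using uminus_cocircuit by (auto simp: eliminates_def supp_comp)

lemma eliminates_reverse: "eliminates L e (- X) Y Z \<Longrightarrow> eliminates L e (- Y) X (- Z)"
  using uminus_cocircuit by (fastforce simp: eliminates_def supp_comp)

text \<open>Both ends have the same sign at \<open>g\<close>, so \<open>orient\<close> negates both
  or neither.\<close>

lemma Gf_edge_exchange:
  assumes XY: "Gf_edge E L f X Y" "X g = Y g" "X g \<noteq> 0"
  shows "Gf_edge E L g (orient g Y) (orient g X)"
proof -
  have c: "comodular E L X Y" "conformal X Y" "X \<in> cocircuits L" "Y \<in> cocircuits L" "X \<in> L"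
    using XY by (auto simp: Gf_edge_def comodular_def cocircuits_def)
  have "conformal Y X" "conformal (- Y) (- X)"
    using c(2) sep_commute[of X Y] by (auto simp: conformal_def sep_def)
  moreover have "X g = 1 \<or> X g = -1" using covector_values[OF c(5), of g] XY by auto
  moreover have "comodular E L Y X" "comodular E L (- Y) (- X)"
    using c comodular_commute comodular_uminus by auto
  ultimately show ?thesis
    using c uminus_cocircuit XY(2) by (auto simp: Gf_edge_def orient_def Gf_vertices_def)
qed

lemma undirected_edge_exchange:
  assumes XY: "undirected_edge E L f g X Y" "X g = Y g" "X g \<noteq> 0"
  shows "undirected_edge E L g f (orient g Y) (orient g X)"
proof -
  obtain Z where Z: "eliminates L f (- X) Y Z" "Z g = 0"
    using XY by (auto simp: undirected_edge_def)
  have Zf: "Z f = 0" using Z by (simp add: eliminates_def)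
  \<comment> \<open>\<open>Z\<close> vanishes at both \<open>f\<close> and \<open>g\<close>, so the
    same cocircuit also eliminates \<open>g\<close>.\<close>
  have "eliminates L g (- X) Y Z" using Z by (auto simp: eliminates_def supp_def)
  then have 1: "eliminates L g (- Y) X (- Z)" by (rule eliminates_reverse)
  then have "eliminates L g (- (- Y)) (- X) Z" using eliminates_uminus[OF 1] by simp
  with 1 Zf have "\<exists>W. eliminates L g (- orient g Y) (orient g X) W \<and> W f = 0"
    using XY(2) by (auto simp: orient_def intro: exI[of _ "- Z"])
  then show ?thesis
    using Gf_edge_exchange XY by (auto simp: undirected_edge_def)
qed

lemma forward_edge_exchange:
  assumes XY: "forward_edge E L f g X Y" "X g = Y g" "X g \<noteq> 0"
  shows "forward_edge E L g f (orient g Y) (orient g X)"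
proof -
  obtain Z where Z: "eliminates L f (- X) Y Z" "Z g = 1" and e: "Gf_edge E L f X Y"
    using XY by (auto simp: forward_edge_def)
  have c: "comodular E L X Y" "X f = 1" "Y f = 1" "X \<in> L" "Y \<in> L"
    using e by (auto simp: Gf_edge_def Gf_vertices_def cocircuits_def)
  have "- Y \<noteq> - X" using c by (auto simp: comodular_def)
  moreover have "g \<in> sep (- Y) X" using XY by (auto simp: sep_def)
  ultimately obtain W where W: "eliminates L g (- Y) X W"
    using eliminates_exists[OF symmetry[OF c(5)] c(4)] by blast
  have Wf: "W f = X g" using exchanged_elimination_sign[OF c(1-3) XY(2,3) Z W] .
  have "\<exists>W. eliminates L g (- orient g Y) (orient g X) W \<and> W f = 1"
  proof (cases "X g = 1")
    case True
    then show ?thesis using W Wf XY(2) by (auto simp: orient_def)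
  next
    case False
    \<comment> \<open>Here both ends are negated, hence \<open>W\<close> too, and
      \<open>W f = -1\<close> becomes 1.\<close>
    then have "X g = -1" using covector_values[OF c(4), of g] XY by auto
    then show ?thesis using eliminates_uminus[OF W] Wf XY(2)
      by (auto simp: orient_def intro!: exI[of _ "- W"])
  qed
  then show ?thesis using Gf_edge_exchange[OF e XY(2,3)] by (simp add: forward_edge_def)
qed

section \<open>From edges to directed cycles\<close>

lemma edge_mono:
  assumes "forward_edge E L f g X Y \<or> undirected_edge E L f g X Y"
  shows "X g \<le> Y g"
  using assms step_mono[of X Y f]
  by (auto simp: forward_edge_def undirected_edge_def Gf_edge_def Gf_vertices_def)

lemma forward_edge_nonzero:
  assumes "forward_edge E L f g X Y" "X g = Y g"
  shows "X g \<noteq> 0"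
proof
  assume "X g = 0"
  obtain Z where Z: "eliminates L f (- X) Y Z" "Z g = 1"
    using assms(1) by (auto simp: forward_edge_def)
  then have "Z g = - X g \<or> Z g = Y g" using eliminates_sign[OF Z(1), of g] by simp
  then show False using Z(2) assms(2) \<open>X g = 0\<close> by auto
qed

lemma directed_cycle_exchange:
  assumes "Gf_directed_cycle E L f g Xs"
  shows "Gf_directed_cycle E L g f (rev (map (orient g) Xs))"
proof -
  let ?n = "length Xs"
  let ?Ys = "rev (map (orient g) Xs)"
  have dist: "distinct Xs"
    and edge: "\<And>i. i < ?n \<Longrightarrow> forward_edge E L f g (Xs ! i) (Xs ! (Suc i mod ?n)) \<or>
        undirected_edge E L f g (Xs ! i) (Xs ! (Suc i mod ?n))"
    using assms by (auto simp: Gf_directed_cycle_def Let_def)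
  obtain m where m: "m < ?n" "forward_edge E L f g (Xs ! m) (Xs ! (Suc m mod ?n))"
    using assms by (auto simp: Gf_directed_cycle_def)
  have n: "?n > 0" using m by auto
  have mono: "(Xs ! i) g \<le> (Xs ! j) g" if "i \<le> j" "j < ?n" for i j
    using that
  proof (induction j rule: dec_induct)
    case (step k)
    then show ?case using edge_mono[OF edge[of k]] by simp
  qed simp
  \<comment> \<open>The closing edge runs from the last vertex back to the first, so the
    nondecreasing values at \<open>g\<close> are all equal.\<close>
  have "(Xs ! (?n - 1)) g \<le> (Xs ! 0) g" using edge_mono[OF edge[of "?n - 1"]] n by simp
  then have const: "(Xs ! i) g = (Xs ! 0) g" if "i < ?n" for i
  proof -
    have "(Xs ! i) g \<le> (Xs ! (?n - 1)) g" "(Xs ! 0) g \<le> (Xs ! i) g"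
      using that by (auto intro: mono)
    then show ?thesis using \<open>(Xs ! (?n - 1)) g \<le> (Xs ! 0) g\<close> by simp
  qed
  have succ: "Suc i mod ?n < ?n" for i using n by simp
  have eq: "(Xs ! i) g = (Xs ! (Suc i mod ?n)) g" if "i < ?n" for i
    using const[OF that] const[OF succ, of i] by simp
  have nz: "(Xs ! i) g \<noteq> 0" if "i < ?n" for i
    using forward_edge_nonzero[OF m(2) eq[OF m(1)]] const[OF m(1)] const[OF that] by simp
  \<comment> \<open>\<open>g\<close> is constant on the cycle, so \<open>orient\<close> acts on all
    vertices by the same sign.\<close>
  have inj: "inj_on (orient g) (set Xs)"
  proof (rule inj_onI)
    fix X Y assume "X \<in> set Xs" "Y \<in> set Xs" and o: "orient g X = orient g Y"
    then have "X g = Y g" using const by (metis in_set_conv_nth)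
    with o show "X = Y" by (auto simp: orient_def split: if_splits)
  qed
  \<comment> \<open>The step leaving position \<open>i\<close> of the reversed list is the step of
    \<open>Xs\<close> leaving \<open>r i\<close>, run backwards.\<close>
  define r where "r i = ?n - Suc (Suc i mod ?n)" for i
  have r: "r i < ?n" "Suc (r i) mod ?n = ?n - Suc i" "r (r i) = i" if "i < ?n" for i
    using reversed_index[OF that] by (simp_all add: r_def)
  have Ys: "?Ys ! i = orient g (Xs ! (Suc (r i) mod ?n))"
      "?Ys ! (Suc i mod length ?Ys) = orient g (Xs ! r i)" if "i < ?n" for i
    using that r(2)[OF that] succ[of i] by (simp_all add: rev_nth r_def)
  have "forward_edge E L g f (?Ys ! i) (?Ys ! (Suc i mod length ?Ys)) \<or>
      undirected_edge E L g f (?Ys ! i) (?Ys ! (Suc i mod length ?Ys))" if "i < ?n" for i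
    unfolding Ys[OF that]
    using edge[OF r(1)[OF that]] eq[OF r(1)[OF that]] nz[OF r(1)[OF that]]
      forward_edge_exchange undirected_edge_exchange by blast
  \<comment> \<open>As \<open>r\<close> is an involution, the forward edge at \<open>m\<close>
    reappears at position \<open>r m\<close>.\<close>
  moreover have "forward_edge E L g f (?Ys ! r m) (?Ys ! (Suc (r m) mod length ?Ys))"
    unfolding Ys[OF r(1)[OF m(1)]] r(3)[OF m(1)]
    using forward_edge_exchange[OF m(2) eq[OF m(1)] nz[OF m(1)]] .
  moreover have "distinct ?Ys" using dist inj by (simp add: distinct_map)
  ultimately show ?thesis
    using r(1)[OF m(1)] unfolding Gf_directed_cycle_def Let_def length_rev length_map by blast
qed

end

theorem theorem2p14:
  fixes E :: "'a set" and L :: "'a signvec set" and g f :: 'a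
  assumes "euclidean_program E L g f"
    and "om_program E L f g"
  shows "euclidean_program E L f g"
proof -
  interpret oriented_matroid E L using assms(2) by (simp add: om_program_def)
  show ?thesis using assms directed_cycle_exchange by (auto simp: euclidean_program_def)
qed

end
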